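(* Let $p$ be an odd prime with $p \geq 5$, and suppose that $3$ is a quadratic non-residue of $p$. Then there exist no $p$ positive integers which are consecutive terms of an arithmetic progression and whose sum of squares is a perfect square. Equivalently, if $a_1, a_2, \ldots, a_p$ are positive integers which are consecutive terms of an arithmetic progression, then there is no integer $t$ with $a_1^2 + a_2^2 + \cdots + a_p^2 = t^2$.
   Context: Integers $a_1, \ldots, a_p$ are consecutive terms of an arithmetic progression if there is an integer $d$ (the common difference) such that $a_i = a_1 + (i-1)d$ for $i = 1, \ldots, p$; increasing, decreasing and constant progressions are all allowed. A perfect square is the square of an integer. For an odd prime $p$ and an integer $a$ not divisible by $p$, $a$ is a quadratic residue of $p$ if the congruence $x^2 \equiv a \pmod{p}$ has an integer solution $x$, and a quadratic non-residue of $p$ otherwise. *)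

theory Defs
  imports
    "HOL-Number_Theory.Quadratic_Reciprocity"
    "HOL-Computational_Algebra.Nth_Powers"
begin

(* A tuple of n integers is represented by its values at the indices 1, ..., n;
   values outside this range are irrelevant.  The common difference d may have any sign
   or be zero. *)
definition consecutive_AP_terms :: "nat \<Rightarrow> (nat \<Rightarrow> int) \<Rightarrow> bool" where
  "consecutive_AP_terms n a \<longleftrightarrow> (\<exists>d::int. \<forall>i\<in>{1..n}. a i = a 1 + (int i - 1) * d)"

end

theory Submission
  imports Defs
begin

text \<open>
  Measured from its middle term \<open>c\<close>, an arithmetic progression of \<open>p\<close> terms with difference \<open>d\<close>
  has sum of squares \<open>p * (c\<^sup>2 + d\<^sup>2 * (p\<^sup>2 - 1) / 12)\<close>, because the terms linear in \<open>d\<close> cancel.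
  If this is a square \<open>t\<^sup>2\<close>, then \<open>p\<close> divides \<open>t\<close>, so \<open>p\<close> also divides the second factor,
  and hence \<open>d\<^sup>2 \<equiv> 12 * c\<^sup>2 (mod p)\<close>. As \<open>12 = 3 * 2\<^sup>2\<close> and \<open>3\<close> is a non-residue, this forces
  \<open>p\<close> to divide both \<open>c\<close> and \<open>d\<close> (lemma \<open>dvd_both_if_dvd_diff_12_square\<close>). Dividing \<open>c\<close>, \<open>d\<close>
  and \<open>t\<close> by \<open>p\<close> gives a smaller solution of the same homogeneous equation, so infinite descent
  leaves only \<open>c = 0\<close> (lemma \<open>middle_term_eq_0\<close>). But the middle term of a positive
  progression is positive.
\<close>

lemma sum_squares_AP:
  fixes a d :: int
  shows "6 * (\<Sum>i=1..n. (a + (int i - 1) * d)\<^sup>2) =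
    int n * (6 * a\<^sup>2 + 6 * a * d * (int n - 1) + d\<^sup>2 * (int n - 1) * (2 * int n - 1))"
  by (induction n) (simp_all add: algebra_simps power2_eq_square)

text \<open>The factor 12 clears the denominator of the variance term, so the identity stays in the
  integers.\<close>

lemma sum_squares_AP_around_middle:
  fixes a d :: int
  assumes "n = 2 * m + 1"
  shows "12 * (\<Sum>i=1..n. (a + (int i - 1) * d)\<^sup>2) =
    int n * (12 * (a + int m * d)\<^sup>2 + d\<^sup>2 * ((int n)\<^sup>2 - 1))"
proof -
  have "12 * (\<Sum>i=1..n. (a + (int i - 1) * d)\<^sup>2) =
    2 * (int n * (6 * a\<^sup>2 + 6 * a * d * (int n - 1) + d\<^sup>2 * (int n - 1) * (2 * int n - 1)))"
    using sum_squares_AP[of a d n] by linarith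
  also have "\<dots> = int n * (12 * (a + int m * d)\<^sup>2 + d\<^sup>2 * ((int n)\<^sup>2 - 1))"
    unfolding assms by (simp add: algebra_simps power2_eq_square)
  finally show ?thesis .
qed

lemma prime_ge_5_not_dvd_12:
  fixes q :: int
  assumes "prime q" and "q \<ge> 5"
  shows "\<not> q dvd 12"
proof
  assume "q dvd 12"
  then have "q dvd 2 * 2 * 3" by simp
  then have "q dvd 2 \<or> q dvd 3"
    using assms(1) by (simp only: prime_dvd_mult_iff) blast
  then show False using assms(2) by (auto dest: zdvd_imp_le)
qed

text \<open>The form \<open>12 * x\<^sup>2 - y\<^sup>2\<close> represents zero modulo \<open>q\<close> only trivially: if \<open>y\<close> were invertible
  modulo \<open>q\<close>, then \<open>(6 * x / y)\<^sup>2\<close> would be \<open>36 * x\<^sup>2 / (12 * x\<^sup>2) = 3\<close>.\<close>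

lemma dvd_both_if_dvd_diff_12_square:
  fixes q c d :: int
  assumes "prime q" and "q \<ge> 5" and nonres: "\<not> QuadRes q 3"
    and dvd: "q dvd 12 * c\<^sup>2 - d\<^sup>2"
  shows "q dvd c" and "q dvd d"
proof -
  show "q dvd d"
  proof (rule ccontr)
    assume "\<not> q dvd d"
    then have "coprime d q"
      using assms(1) prime_imp_coprime coprime_commute by blast
    then obtain e where e: "[d * e = 1] (mod q)"
      using cong_solve_coprime_int by blast
    have "[12 * c\<^sup>2 = d\<^sup>2] (mod q)" using dvd by (simp add: cong_iff_dvd_diff)
    then have "[3 * e\<^sup>2 * (12 * c\<^sup>2) = 3 * e\<^sup>2 * d\<^sup>2] (mod q)"
      by (rule cong_scalar_left)
    then have "[(6 * c * e)\<^sup>2 = 3 * (d * e)\<^sup>2] (mod q)"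
      by (simp add: power_mult_distrib mult_ac)
    also have "[3 * (d * e)\<^sup>2 = 3 * 1\<^sup>2] (mod q)"
      by (intro cong_scalar_left cong_pow e)
    finally show False using nonres unfolding QuadRes_def by auto
  qed
  then have "q dvd d\<^sup>2" by (simp add: power2_eq_square)
  with dvd have "q dvd 12 * c\<^sup>2"
    using dvd_add[of q "12 * c\<^sup>2 - d\<^sup>2" "d\<^sup>2"] by simp
  then have "q dvd c\<^sup>2"
    using assms(1) prime_ge_5_not_dvd_12[OF assms(1,2)] prime_dvd_mult_iff by blast
  then show "q dvd c" using assms(1) prime_dvd_power by blast
qed

text \<open>The equation is homogeneous in \<open>(c, d, t)\<close>, so the common factor \<open>q\<close> can be removed;
  the descent runs on the absolute value of \<open>c\<close>.\<close>

lemma middle_term_eq_0: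
  fixes q c d t :: int
  assumes q: "prime q" "q \<ge> 5" "\<not> QuadRes q 3"
    and "12 * t\<^sup>2 = q * (12 * c\<^sup>2 + d\<^sup>2 * (q\<^sup>2 - 1))"
  shows "c = 0"
  using assms(4)
proof (induction "nat \<bar>c\<bar>" arbitrary: c d t rule: less_induct)
  case less
  note eq = less.prems
  have "q dvd 12 * t\<^sup>2" unfolding eq by simp
  then have "q dvd t\<^sup>2"
    using q(1) prime_ge_5_not_dvd_12[OF q(1,2)] prime_dvd_mult_iff by blast
  then have "q dvd t" using q(1) prime_dvd_power by blast
  then obtain s where t: "t = q * s" by blast
  have "q * (12 * q * s\<^sup>2) = q * (12 * c\<^sup>2 + d\<^sup>2 * (q\<^sup>2 - 1))"
    using eq unfolding t by (simp add: power2_eq_square algebra_simps)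
  then have "12 * q * s\<^sup>2 = 12 * c\<^sup>2 + d\<^sup>2 * (q\<^sup>2 - 1)"
    using q(2) by simp
  then have "12 * c\<^sup>2 - d\<^sup>2 = q * (12 * s\<^sup>2 - d\<^sup>2 * q)"
    by (simp add: power2_eq_square algebra_simps)
  then have dvd: "q dvd 12 * c\<^sup>2 - d\<^sup>2" by simp
  obtain c' d' where c: "c = q * c'" and d: "d = q * d'"
    using dvd_both_if_dvd_diff_12_square[OF q dvd] by (meson dvdE)
  have "q\<^sup>2 * (12 * s\<^sup>2) = q\<^sup>2 * (q * (12 * c'\<^sup>2 + d'\<^sup>2 * (q\<^sup>2 - 1)))"
    using eq unfolding t c d by (simp add: power2_eq_square algebra_simps)
  then have eq': "12 * s\<^sup>2 = q * (12 * c'\<^sup>2 + d'\<^sup>2 * (q\<^sup>2 - 1))"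
    using q(2) by simp
  show "c = 0"
  proof (rule ccontr)
    assume "c \<noteq> 0"
    then have "c' \<noteq> 0" using c by simp
    then have "1 * \<bar>c'\<bar> < q * \<bar>c'\<bar>"
      using q(2) by (intro mult_strict_right_mono) auto
    then have "nat \<bar>c'\<bar> < nat \<bar>c\<bar>"
      using c q(2) by (simp add: abs_mult)
    then have "c' = 0" using less.hyps eq' by blast
    with \<open>c' \<noteq> 0\<close> show False by blast
  qed
qed

theorem theorem2:
  fixes p :: nat
  assumes "prime p" and "odd p" and "p \<ge> 5"
    and "\<not> QuadRes (int p) 3"
  shows "\<not> (\<exists>a :: nat \<Rightarrow> int. (\<forall>i\<in>{1..p}. a i > 0) \<and> consecutive_AP_terms p a \<and>
           is_square (\<Sum>i=1..p. (a i)\<^sup>2))"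
proof
  assume "\<exists>a :: nat \<Rightarrow> int. (\<forall>i\<in>{1..p}. a i > 0) \<and> consecutive_AP_terms p a \<and>
           is_square (\<Sum>i=1..p. (a i)\<^sup>2)"
  then obtain a :: "nat \<Rightarrow> int" and d t where pos: "\<forall>i\<in>{1..p}. a i > 0"
    and AP: "\<forall>i\<in>{1..p}. a i = a 1 + (int i - 1) * d"
    and t: "(\<Sum>i=1..p. (a i)\<^sup>2) = t\<^sup>2"
    unfolding consecutive_AP_terms_def by (metis is_nth_power_def)
  obtain m where m: "p = 2 * m + 1" using assms(2) by (rule oddE)
  have "(\<Sum>i=1..p. (a i)\<^sup>2) = (\<Sum>i=1..p. (a 1 + (int i - 1) * d)\<^sup>2)"
  proof (rule sum.cong)
    fix i assume "i \<in> {1..p}"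
    with AP have "a i = a 1 + (int i - 1) * d" by blast
    then show "(a i)\<^sup>2 = (a 1 + (int i - 1) * d)\<^sup>2" by (rule arg_cong)
  qed (rule refl)
  then have "12 * t\<^sup>2 = int p * (12 * (a 1 + int m * d)\<^sup>2 + d\<^sup>2 * ((int p)\<^sup>2 - 1))"
    using t sum_squares_AP_around_middle[OF m, of "a 1" d] by simp
  then have "a 1 + int m * d = 0"
    using assms by (intro middle_term_eq_0) auto
  moreover have "m + 1 \<in> {1..p}" using m by simp
  then have "a (m + 1) = a 1 + (int (m + 1) - 1) * d" and "a (m + 1) > 0"
    using AP pos by blast+
  ultimately show False by simp
qed

end
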